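(* Let $n\ge 6$. Among all unbalanced signed complete graphs of order $n$ whose negative edges form a spanning tree, let $\Sigma=(K_n,T^-)$ (with $T$ the spanning tree formed by the negative edges) be one that maximizes the largest adjacency eigenvalue $\lambda_1(A(\Sigma))$. Then $T\cong T_{1,n-3}$.
   Context: A signed graph $\Sigma=(G,\sigma)$ is a simple connected graph $G=(V,E)$ together with $\sigma:E\to\{-1,1\}$; an edge $e$ is negative if $\sigma(e)=-1$. A cycle is positive if it contains an even number of negative edges and negative otherwise; $\Sigma$ is balanced if all its cycles are positive, and unbalanced otherwise. The adjacency matrix $A(\Sigma)$ has $(i,j)$ entry $\sigma(v_iv_j)$ if $v_i\sim v_j$ and $0$ otherwise; its eigenvalues are $\lambda_1(A(\Sigma))\ge\dots\ge\lambda_n(A(\Sigma))$. $(K_n,H^-)$ denotes the signed complete graph on $n$ vertices whose negative edges are exactly the edges of the subgraph $H$. $T_{a,b}$ denotes the double star obtained from $P_2$ (a single edge) by attaching $a$ pendent vertices to one end vertex and $b$ pendent vertices to the other. *)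

theory Defs
  imports "Jordan_Normal_Form.Char_Poly"
begin

record 'a ugraph =
  verts :: "'a set"
  edges :: "'a set set"

record 'a sgraph = "'a ugraph" +
  sign :: "'a set \<Rightarrow> int"

definition all_pairs :: "'a set \<Rightarrow> 'a set set" where
  "all_pairs V = {e. e \<subseteq> V \<and> card e = 2}"

definition simple_graph :: "('a, 'm) ugraph_scheme \<Rightarrow> bool" where
  "simple_graph G \<longleftrightarrow> finite (verts G) \<and> edges G \<subseteq> all_pairs (verts G)"

definition is_walk :: "('a, 'm) ugraph_scheme \<Rightarrow> 'a list \<Rightarrow> bool" where
  "is_walk G p \<longleftrightarrow>
     p \<noteq> [] \<and> set p \<subseteq> verts G \<and> successively (\<lambda>u v. {u, v} \<in> edges G) p"

definition connected_graph :: "('a, 'm) ugraph_scheme \<Rightarrow> bool" where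
  "connected_graph G \<longleftrightarrow> verts G \<noteq> {} \<and>
     (\<forall>u \<in> verts G. \<forall>v \<in> verts G. \<exists>p. is_walk G p \<and> hd p = u \<and> last p = v)"

(* A cycle is given by the list of its vertices; the first vertex is not repeated at the end. *)
definition is_cycle :: "('a, 'm) ugraph_scheme \<Rightarrow> 'a list \<Rightarrow> bool" where
  "is_cycle G c \<longleftrightarrow>
     is_walk G c \<and> distinct c \<and> length c \<ge> 3 \<and> {last c, hd c} \<in> edges G"

definition cycle_edges :: "'a list \<Rightarrow> 'a set set" where
  "cycle_edges c = {{c ! i, c ! (Suc i mod length c)} | i. i < length c}"

definition is_tree :: "('a, 'm) ugraph_scheme \<Rightarrow> bool" where
  "is_tree G \<longleftrightarrow> simple_graph G \<and> connected_graph G \<and> (\<nexists>c. is_cycle G c)"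

definition is_spanning_tree :: "'a ugraph \<Rightarrow> 'a ugraph \<Rightarrow> bool" where
  "is_spanning_tree T G \<longleftrightarrow> is_tree T \<and> verts T = verts G \<and> edges T \<subseteq> edges G"

definition graph_isomorphic :: "'a ugraph \<Rightarrow> 'b ugraph \<Rightarrow> bool" where
  "graph_isomorphic G H \<longleftrightarrow> (\<exists>f. bij_betw f (verts G) (verts H) \<and>
     (\<forall>u \<in> verts G. \<forall>v \<in> verts G. {u, v} \<in> edges G \<longleftrightarrow> {f u, f v} \<in> edges H))"

definition complete_ugraph :: "nat \<Rightarrow> nat ugraph" where
  "complete_ugraph n = \<lparr>verts = {0..<n}, edges = all_pairs {0..<n}\<rparr>"

(* The end vertices of the central edge are 0 and 1; the vertices 2, ..., a + 1 are pendent
   at 0, and a + 2, ..., a + b + 1 are pendent at 1. *)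
definition double_star :: "nat \<Rightarrow> nat \<Rightarrow> nat ugraph" where
  "double_star a b = \<lparr>verts = {0..<a + b + 2},
     edges = {{0, 1}} \<union> {{0, i} | i. i \<in> {2..<a + 2}} \<union> {{1, i} | i. i \<in> {a + 2..<a + b + 2}}\<rparr>"

definition signed_graph :: "'a sgraph \<Rightarrow> bool" where
  "signed_graph S \<longleftrightarrow>
     simple_graph S \<and> connected_graph S \<and> (\<forall>e \<in> edges S. sign S e \<in> {-1, 1})"

definition positive_cycle :: "'a sgraph \<Rightarrow> 'a list \<Rightarrow> bool" where
  "positive_cycle S c \<longleftrightarrow> is_cycle S c \<and> even (card {e \<in> cycle_edges c. sign S e = -1})"

definition balanced :: "'a sgraph \<Rightarrow> bool" where
  "balanced S \<longleftrightarrow> (\<forall>c. is_cycle S c \<longrightarrow> positive_cycle S c)"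

(* (K_n, H^-), on the vertex set {0, ..., n - 1} *)
definition signed_complete :: "nat \<Rightarrow> nat ugraph \<Rightarrow> nat sgraph" where
  "signed_complete n H = \<lparr>verts = verts (complete_ugraph n), edges = edges (complete_ugraph n),
     sign = (\<lambda>e. if e \<in> edges H then -1 else 1)\<rparr>"

(* Only meant for signed graphs whose vertex set is an initial segment {0, ..., n - 1}. *)
definition adjacency_matrix :: "nat sgraph \<Rightarrow> real mat" where
  "adjacency_matrix S = mat (card (verts S)) (card (verts S))
     (\<lambda>(i, j). if {i, j} \<in> edges S then real_of_int (sign S {i, j}) else 0)"

(* A real symmetric matrix of positive dimension has a nonempty finite set of (real)
   eigenvalues, so Max is meaningful for every adjacency matrix of positive order. *)
definition largest_eigenvalue :: "real mat \<Rightarrow> real" where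
  "largest_eigenvalue A = Max {k. eigenvalue A k}"

lemma signed_graph_signed_complete:
  assumes "n > 0"
  shows "signed_graph (signed_complete n H)"
proof -
  have "\<exists>p. is_walk (signed_complete n H) p \<and> hd p = u \<and> last p = v" if "u < n" "v < n" for u v
  proof (cases "u = v")
    case True
    then show ?thesis using that
      by (intro exI[of _ "[u]"]) (auto simp: is_walk_def signed_complete_def complete_ugraph_def)
  next
    case False
    then show ?thesis using that
      by (intro exI[of _ "[u, v]"])
        (auto simp: is_walk_def signed_complete_def complete_ugraph_def all_pairs_def)
  qed
  then show ?thesis using assms
    by (auto simp: signed_graph_def simple_graph_def connected_graph_def signed_complete_def
        complete_ugraph_def)
qed

end

theory Submission
  imports Defs "HOL-Analysis.Function_Topology"
begin

text \<open>Let \<open>x\<close> be a unit eigenvector for the largest eigenvalue \<open>l\<close> of \<open>(K\<^sub>n, T\<^sup>-)\<close>. Switching at the set \<open>S\<close> of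
  vertices where \<open>x\<close> is negative replaces \<open>x\<close> by \<open>y = \<bar>x\<bar>\<close> and the set of negative edges by the symmetric
  difference \<open>B\<close> of \<open>E(T)\<close> and the cut of \<open>S\<close>. Since \<open>T\<close> is a tree but not a star and \<open>n \<ge> 6\<close>, the set \<open>B\<close>
  contains a path \<open>P = {ma, mb}\<close>, and if \<open>B = P\<close> then \<open>T\<close> is the double star \<open>T\<^sub>1\<^sub>,\<^sub>n\<^sub>-\<^sub>3\<close>. As \<open>y \<ge> 0\<close>, dropping negative
  edges does not decrease the quadratic form, so \<open>l\<close> is at most the value at \<open>y\<close> of the form of \<open>(K\<^sub>n, P\<^sup>-)\<close>.
  Switching at \<open>a\<close> turns \<open>(K\<^sub>n, P\<^sup>-)\<close> into the double star competitor, so by maximality of \<open>T\<close> this value is at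
  most \<open>l\<close>. Equality makes \<open>y\<close> an eigenvector of \<open>(K\<^sub>n, P\<^sup>-)\<close>, hence positive everywhere, and then a further
  edge in \<open>B\<close> would make the first inequality strict.\<close>

section \<open>Quadratic forms and the variational description of the largest eigenvalue\<close>

definition quad :: "nat \<Rightarrow> (nat \<Rightarrow> nat \<Rightarrow> real) \<Rightarrow> (nat \<Rightarrow> real) \<Rightarrow> real" where
  "quad n a x = (\<Sum>i<n. \<Sum>j<n. a i j * x i * x j)"

lemma quad_scale: "quad n a (\<lambda>i. c * x i) = c\<^sup>2 * quad n a x"
  by (simp add: quad_def sum_distrib_left power2_eq_square algebra_simps)

lemma quad_perturb:
  assumes sym: "\<And>i j. a i j = a j i" and i: "i < n"
  shows "quad n a (\<lambda>j. x j + t * of_bool (j = i))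
    = quad n a x + 2 * t * (\<Sum>j<n. a i j * x j) + t\<^sup>2 * a i i"
proof -
  have "quad n a (\<lambda>j. x j + t * of_bool (j = i))
    = quad n a x + t * (\<Sum>p<n. \<Sum>q<n. a p q * of_bool (p = i) * x q)
      + t * (\<Sum>p<n. \<Sum>q<n. a p q * x p * of_bool (q = i))
      + t\<^sup>2 * (\<Sum>p<n. \<Sum>q<n. a p q * of_bool (p = i) * of_bool (q = i))"
    unfolding quad_def
    by (simp add: sum_distrib_left sum.distrib[symmetric] power2_eq_square algebra_simps
        del: sum_mult_of_bool_eq sum_of_bool_mult_eq)
  also have "(\<Sum>p<n. \<Sum>q<n. a p q * of_bool (p = i) * x q) = (\<Sum>p<n. of_bool (p = i) * (\<Sum>q<n. a p q * x q))"
    by (simp add: sum_distrib_left mult.commute mult.left_commute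
        del: sum_mult_of_bool_eq sum_of_bool_mult_eq)
  also have "\<dots> = (\<Sum>j<n. a i j * x j)"
    using i by (simp add: of_bool_def if_distrib[of "\<lambda>c. c * _"] cong: if_cong)
  also have "(\<Sum>p<n. \<Sum>q<n. a p q * x p * of_bool (q = i)) = (\<Sum>j<n. a i j * x j)"
    using i by (simp add: of_bool_def if_distrib[of "\<lambda>c. _ * c"] sym[of _ i] cong: if_cong)
  also have "(\<Sum>p<n. \<Sum>q<n. a p q * of_bool (p = i) * of_bool (q = i)) = a i i"
    using i by (simp add: of_bool_def if_distrib[of "\<lambda>c. _ * c"] cong: if_cong)
  finally show ?thesis by (simp add: algebra_simps)
qed

lemma sum_squares_perturb:
  fixes x :: "nat \<Rightarrow> real"
  assumes i: "i < n"
  shows "(\<Sum>j<n. (x j + t * of_bool (j = i))\<^sup>2) = (\<Sum>j<n. (x j)\<^sup>2) + 2 * t * x i + t\<^sup>2"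
proof -
  have "(x j + t * of_bool (j = i))\<^sup>2 = (x j)\<^sup>2 + (if j = i then 2 * t * x i + t\<^sup>2 else 0)" for j
    by (simp add: power2_eq_square algebra_simps)
  then show ?thesis using i by (simp add: sum.distrib)
qed

text \<open>First-order condition: moving \<open>x\<close> by \<open>t\<close> in coordinate
  \<open>i\<close> turns the bound into t^2 c - 2 t r >= 0, where \<open>r\<close> is the residual
  of the eigenvalue equation in row \<open>i\<close>. This can hold for all \<open>t\<close> only if
  \<open>r\<close> is 0.\<close>

lemma eigenvector_of_maximiser:
  assumes sym: "\<And>i j. a i j = a j i"
    and bound: "\<And>y. quad n a y \<le> l * (\<Sum>i<n. (y i)\<^sup>2)"
    and eq: "quad n a x = l * (\<Sum>i<n. (x i)\<^sup>2)"
    and i: "i < n"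
  shows "(\<Sum>j<n. a i j * x j) = l * x i"
proof (rule ccontr)
  define r where "r = (\<Sum>j<n. a i j * x j) - l * x i"
  define c where "c = l - a i i"
  assume "\<not> ?thesis"
  then have r: "r \<noteq> 0" by (simp add: r_def)
  have key: "2 * t * r \<le> t\<^sup>2 * c" for t
    using bound[of "\<lambda>j. x j + t * of_bool (j = i)"] eq
    unfolding quad_perturb[OF sym i] sum_squares_perturb[OF i] r_def c_def
    by (simp add: algebra_simps)
  \<comment> \<open>A positive upper bound for \<open>c\<close>, whatever the sign of
    \<open>c\<close>. At t = r/d the inequality \<open>key\<close> gives 2 r^2/d <= r^2/d, which
    forces r = 0.\<close>
  define d where "d = \<bar>c\<bar> + 1"
  have d: "d > 0" "c \<le> d" by (auto simp: d_def)
  have "2 * (r / d) * r \<le> (r / d)\<^sup>2 * c" by (rule key)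
  also have "\<dots> \<le> (r / d)\<^sup>2 * d" using d by (intro mult_left_mono) auto
  also have "\<dots> = (r / d) * r" using d by (simp add: power2_eq_square)
  finally have "r\<^sup>2 / d \<le> 0" by (simp add: power2_eq_square)
  then show False using r d by (simp add: divide_le_0_iff)
qed

text \<open>The form is continuous, so it has a maximum on the compact unit sphere; homogeneity of
  degree 2 extends the bound to all vectors.\<close>

lemma quad_attains_max:
  assumes n: "n > 0"
  obtains x l where "(\<Sum>i<n. (x i)\<^sup>2) = 1" "quad n a x = l"
    "\<And>y. quad n a y \<le> l * (\<Sum>i<n. (y i)\<^sup>2)"
proof -
  \<comment> \<open>Vectors are functions on all naturals with the product topology. Freezing the
    coordinates from \<open>n\<close> on at 0 makes this box compact by Tychonoff, and
    \<open>quad\<close> does not see those coordinates.\<close>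
  define K :: "(nat \<Rightarrow> real) set" where
    "K = PiE UNIV (\<lambda>i. if i < n then {-1..1} else {0})"
  define C where "C = K \<inter> {x. (\<Sum>i<n. (x i)\<^sup>2) = 1}"
  have K: "compact K"
    using compactin_PiE[of "\<lambda>_. euclideanreal" "UNIV :: nat set" "\<lambda>i. if i < n then {-1..1} else {0}"]
    by (auto simp: K_def euclidean_product_topology)
  have coord: "continuous_on A (\<lambda>x. x i)" for A :: "(nat \<Rightarrow> real) set" and i
    by (rule continuous_on_subset[OF continuous_on_product_coordinates]) auto
  have "closed {x :: nat \<Rightarrow> real. (\<Sum>i<n. (x i)\<^sup>2) = 1}"
    by (intro closed_Collect_eq continuous_intros coord)
  then have C: "compact C" unfolding C_def using K by (rule compact_Int_closed[rotated])
  have normalised: "(\<lambda>i. if i < n then y i else 0) \<in> C" if "(\<Sum>i<n. (y i)\<^sup>2) = 1" for y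
  proof -
    have "\<bar>y i\<bar> \<le> 1" if "i < n" for i
    proof -
      have "(y i)\<^sup>2 \<le> (\<Sum>i<n. (y i)\<^sup>2)" using that by (intro member_le_sum) auto
      then show ?thesis using \<open>(\<Sum>i<n. (y i)\<^sup>2) = 1\<close> by (simp add: abs_square_le_1)
    qed
    then show ?thesis using that by (auto simp: C_def K_def abs_le_iff minus_le_iff)
  qed
  have "(\<Sum>i<n. (if i = 0 then 1 else 0 :: real)\<^sup>2) = 1"
    using n by (simp add: if_distrib[of "\<lambda>c. c\<^sup>2"] cong: if_cong)
  from normalised[OF this] have "C \<noteq> {}" by blast
  moreover have "continuous_on C (quad n a)"
    unfolding quad_def by (intro continuous_intros coord)
  ultimately obtain x where x: "x \<in> C" and max: "\<And>y. y \<in> C \<Longrightarrow> quad n a y \<le> quad n a x"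
    using continuous_attains_sup[OF C] by blast
  have "quad n a y \<le> quad n a x * (\<Sum>i<n. (y i)\<^sup>2)" for y
  proof (cases "(\<Sum>i<n. (y i)\<^sup>2) = 0")
    case True
    then have "\<And>i. i < n \<Longrightarrow> y i = 0" by (simp add: sum_nonneg_eq_0_iff)
    then show ?thesis using True by (simp add: quad_def)
  next
    case False
    define N where "N = (\<Sum>i<n. (y i)\<^sup>2)"
    have N: "N > 0" using False by (simp add: N_def less_le sum_nonneg)
    define z where "z = (\<lambda>i. (1 / sqrt N) * y i)"
    have "(\<Sum>i<n. (z i)\<^sup>2) = (1 / sqrt N)\<^sup>2 * N"
      by (simp only: z_def N_def power_mult_distrib sum_distrib_left)
    then have "(\<Sum>i<n. (z i)\<^sup>2) = 1" using N by (simp add: power_divide)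
    from max[OF normalised[OF this]] have "quad n a z \<le> quad n a x"
      by (simp add: quad_def)
    then have "quad n a y / N \<le> quad n a x"
      unfolding z_def quad_scale using N by (simp add: power_divide)
    then show ?thesis using N by (simp add: N_def[symmetric] divide_le_eq)
  qed
  then show thesis using x that[of x] by (auto simp: C_def)
qed

lemma eigenvalue_mat_iff:
  "eigenvalue (mat n n (\<lambda>(i, j). a i j)) k \<longleftrightarrow>
    (\<exists>x. (\<exists>i<n. x i \<noteq> 0) \<and> (\<forall>i<n. (\<Sum>j<n. a i j * x j) = k * x i))" (is "?l \<longleftrightarrow> ?r")
proof
  assume ?l
  then obtain v where v: "v \<in> carrier_vec n" "v \<noteq> 0\<^sub>v n"
    "mat n n (\<lambda>(i, j). a i j) *\<^sub>v v = k \<cdot>\<^sub>v v"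
    by (auto simp: eigenvalue_def eigenvector_def)
  have "(\<Sum>j<n. a i j * v $ j) = k * v $ i" if "i < n" for i
    using arg_cong[OF v(3), of "\<lambda>w. w $ i"] that v(1)
    by (simp add: scalar_prod_def atLeast0LessThan)
  moreover have "\<exists>i<n. v $ i \<noteq> 0"
    using v(1,2) by (metis carrier_vecD eq_vecI index_zero_vec)
  ultimately show ?r by blast
next
  assume ?r
  then obtain x where x: "\<exists>i<n. x i \<noteq> 0" "\<forall>i<n. (\<Sum>j<n. a i j * x j) = k * x i" by blast
  have "vec n x \<noteq> 0\<^sub>v n" using x(1) by (metis index_vec index_zero_vec(1))
  moreover have "mat n n (\<lambda>(i, j). a i j) *\<^sub>v vec n x = k \<cdot>\<^sub>v vec n x"
    using x(2) by (intro eq_vecI) (auto simp: scalar_prod_def atLeast0LessThan)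
  ultimately show ?l by (auto simp: eigenvalue_def eigenvector_def intro!: exI[of _ "vec n x"])
qed

text \<open>The maximum \<open>m\<close> of the form on the unit sphere is an eigenvalue by the
  first-order condition. Any eigenvalue is the Rayleigh quotient of its eigenvector, hence at most
  \<open>m\<close>. As the eigenvalues are finitely many roots of the characteristic polynomial,
  \<open>Max\<close> returns \<open>m\<close>.\<close>

lemma largest_eigenvalue_variational:
  assumes sym: "\<And>i j. a i j = a j i" and n: "n > 0"
  defines "l \<equiv> largest_eigenvalue (mat n n (\<lambda>(i, j). a i j))"
  shows "quad n a y \<le> l * (\<Sum>i<n. (y i)\<^sup>2)"
    and "\<exists>x. (\<Sum>i<n. (x i)\<^sup>2) = 1 \<and> quad n a x = l"
proof -
  obtain x m where x: "(\<Sum>i<n. (x i)\<^sup>2) = 1" "quad n a x = m"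
    and bound: "\<And>y. quad n a y \<le> m * (\<Sum>i<n. (y i)\<^sup>2)"
    using quad_attains_max[OF n, of a] by blast
  let ?A = "mat n n (\<lambda>(i, j). a i j)"
  have "(\<Sum>j<n. a i j * x j) = m * x i" if "i < n" for i
    using eigenvector_of_maximiser[OF sym bound _ that, of x] x by simp
  moreover have "\<exists>i<n. x i \<noteq> 0"
  proof (rule ccontr)
    assume "\<not> ?thesis"
    then have "(\<Sum>i<n. (x i)\<^sup>2) = 0" by simp
    then show False using x(1) by simp
  qed
  ultimately have m: "eigenvalue ?A m" unfolding eigenvalue_mat_iff by blast
  have le: "k \<le> m" if "eigenvalue ?A k" for k
  proof -
    obtain y where y: "\<exists>i<n. y i \<noteq> 0" "\<forall>i<n. (\<Sum>j<n. a i j * y j) = k * y i"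
      using \<open>eigenvalue ?A k\<close> unfolding eigenvalue_mat_iff by blast
    have "quad n a y = (\<Sum>i<n. y i * (\<Sum>j<n. a i j * y j))"
      by (simp add: quad_def sum_distrib_left algebra_simps)
    also have "\<dots> = k * (\<Sum>i<n. (y i)\<^sup>2)"
      using y(2) by (simp add: sum_distrib_left power2_eq_square algebra_simps)
    finally have "k * (\<Sum>i<n. (y i)\<^sup>2) \<le> m * (\<Sum>i<n. (y i)\<^sup>2)" using bound[of y] by simp
    moreover have "(\<Sum>i<n. (y i)\<^sup>2) > 0" using y(1) by (auto intro: sum_pos2)
    ultimately show ?thesis by simp
  qed
  have "finite {k. eigenvalue ?A k}"
  proof -
    have A: "?A \<in> carrier_mat n n" by simp
    have "char_poly ?A \<noteq> 0" using degree_monic_char_poly[OF A] by auto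
    then show ?thesis by (simp add: eigenvalue_root_char_poly[OF A] poly_roots_finite)
  qed
  then have "l = m" unfolding l_def largest_eigenvalue_def using m le by (intro Max_eqI) auto
  then show "quad n a y \<le> l * (\<Sum>i<n. (y i)\<^sup>2)" "\<exists>x. (\<Sum>i<n. (x i)\<^sup>2) = 1 \<and> quad n a x = l"
    using bound x by auto
qed

section \<open>Signed complete graphs and switching\<close>

definition sign_entry :: "nat set set \<Rightarrow> nat \<Rightarrow> nat \<Rightarrow> real" where
  "sign_entry E i j = (if i = j then 0 else if {i, j} \<in> E then -1 else 1)"

lemma sign_entry_sym: "sign_entry E i j = sign_entry E j i"
  by (simp add: sign_entry_def insert_commute)

lemma adjacency_matrix_signed_complete:
  "adjacency_matrix (signed_complete n T) = mat n n (\<lambda>(i, j). sign_entry (edges T) i j)"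
  by (intro eq_matI)
    (auto simp: adjacency_matrix_def signed_complete_def complete_ugraph_def sign_entry_def
      all_pairs_def)

text \<open>Inequality of truth values is exclusive or, so this is the symmetric difference of
  \<open>E\<close> and the cut of \<open>S\<close>, restricted to vertices below \<open>n\<close>.
  Elements of \<open>S\<close> from \<open>n\<close> on have no effect.\<close>

definition switched :: "nat \<Rightarrow> nat set \<Rightarrow> nat set set \<Rightarrow> nat set set" where
  "switched n S E =
     {{i, j} | i j. i < n \<and> j < n \<and> i \<noteq> j \<and> ({i, j} \<in> E) \<noteq> ((i \<in> S) \<noteq> (j \<in> S))}"

lemma switched_iff [simp]:
  "{i, j} \<in> switched n S E \<longleftrightarrow> i < n \<and> j < n \<and> i \<noteq> j \<and> ({i, j} \<in> E) \<noteq> ((i \<in> S) \<noteq> (j \<in> S))"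
  unfolding switched_def by (auto simp: doubleton_eq_iff insert_commute)

lemma switched_pairs: "switched n S E \<subseteq> all_pairs {0..<n}"
  by (auto simp: switched_def all_pairs_def)

lemma all_pairs_eqI:
  assumes "E \<subseteq> all_pairs V" "F \<subseteq> all_pairs V"
    and "\<And>i j. i \<in> V \<Longrightarrow> j \<in> V \<Longrightarrow> i \<noteq> j \<Longrightarrow> {i, j} \<in> E \<longleftrightarrow> {i, j} \<in> F"
  shows "E = F"
proof -
  have "e \<in> E \<longleftrightarrow> e \<in> F" if "e \<in> all_pairs V" for e
    using that assms(3) by (auto simp: all_pairs_def card_2_iff)
  then show ?thesis using assms(1,2) by blast
qed

text \<open>Switching conjugates the adjacency matrix by a diagonal matrix of signs, so flipping the
  same signs in the vector preserves the form.\<close>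

lemma quad_switched:
  "quad n (sign_entry (switched n S E)) (\<lambda>i. (if i \<in> S then -1 else 1) * x i)
    = quad n (sign_entry E) x"
  unfolding quad_def by (intro sum.cong refl) (auto simp: sign_entry_def)

section \<open>Crossing edges, cycles, and balance of negative stars\<close>

lemma connected_crossing_edge:
  assumes "connected_graph G" "u \<in> verts G" "u \<in> X" "v \<in> verts G" "v \<notin> X"
  obtains p q where "p \<in> X" "q \<notin> X" "q \<in> verts G" "p \<in> verts G" "{p, q} \<in> edges G"
proof -
  have "\<exists>p q. p \<in> X \<and> q \<notin> X \<and> q \<in> verts G \<and> p \<in> verts G \<and> {p, q} \<in> edges G"
    if "w \<noteq> []" "hd w \<in> X" "last w \<notin> X" "set w \<subseteq> verts G" "successively (\<lambda>u v. {u, v} \<in> edges G) w"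
    for w
    using that
  proof (induction w)
    case (Cons a w)
    show ?case
    proof (cases w)
      case (Cons b w')
      then show ?thesis using Cons.IH Cons.prems by (cases "b \<in> X") auto
    qed (use Cons.prems in auto)
  qed simp
  then show thesis using assms that unfolding connected_graph_def is_walk_def by metis
qed

lemma is_cycle_edge:
  assumes "is_cycle G c" "i < length c"
  shows "{c ! i, c ! (Suc i mod length c)} \<in> edges G"
proof (cases "Suc i = length c")
  case True
  moreover from this have "c \<noteq> []" by auto
  moreover from this have "last c = c ! i" by (simp add: last_conv_nth True[symmetric])
  ultimately show ?thesis using assms by (simp add: is_cycle_def hd_conv_nth)
next
  case False
  then show ?thesis using assms by (auto simp: is_cycle_def is_walk_def successively_conv_nth)
qed

lemma cycle_edges_image:
  "cycle_edges c = (\<lambda>i. {c ! i, c ! (Suc i mod length c)}) ` {..<length c}"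
  by (auto simp: cycle_edges_def)

text \<open>If \<open>v\<close> has index \<open>i\<close> in the cycle, its two edges go to the
  cyclic successor \<open>s i\<close> and the cyclic predecessor \<open>p\<close>. These differ
  because the length is at least 3.\<close>

lemma cycle_edges_at:
  assumes "is_cycle G c" "v \<in> set c"
  obtains y z where "y \<noteq> z" "{v, y} \<in> edges G" "{v, z} \<in> edges G"
    "{e \<in> cycle_edges c. v \<in> e} = {{v, y}, {v, z}}"
proof -
  define k where "k = length c"
  have k: "k \<ge> 3" and d: "distinct c" using assms by (auto simp: is_cycle_def k_def)
  obtain i where i: "i < k" "c ! i = v" using assms(2) by (auto simp: in_set_conv_nth k_def)
  define s where "s j = (if Suc j = k then 0 else Suc j)" for j
  define p where "p = (if i = 0 then k - 1 else i - 1)"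
  have s: "Suc j mod k = s j" if "j < k" for j using that by (auto simp: s_def)
  have lt: "s j < k" if "j < k" for j using that by (auto simp: s_def)
  have p: "p < k" "s p = i" "s i \<noteq> p" "s i \<noteq> i" "p \<noteq> i"
    and sp: "s j = i \<Longrightarrow> j < k \<Longrightarrow> j = p" for j
    using i k by (auto simp: p_def s_def split: if_splits)
  have inj: "c ! j = v \<longleftrightarrow> j = i" if "j < k" for j
    using that i d by (auto simp: k_def nth_eq_iff_index_eq)
  define f where "f j = {c ! j, c ! s j}" for j
  have mem: "v \<in> f j \<longleftrightarrow> j = i \<or> s j = i" if "j < k" for j
    using inj[OF that] inj[OF lt[OF that]] by (auto simp: f_def)
  have "cycle_edges c = {f j | j. j < k}"
    unfolding f_def cycle_edges_image k_def[symmetric] using s by auto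
  then have "{e \<in> cycle_edges c. v \<in> e} = {f j | j. j < k \<and> (j = i \<or> s j = i)}"
    using mem by blast
  also have "\<dots> = {{v, c ! s i}, {v, c ! p}}"
  proof -
    have "{f j | j. j < k \<and> (j = i \<or> s j = i)} = {f i, f p}" using i p sp by blast
    moreover have "f i = {v, c ! s i}" "f p = {v, c ! p}" using i p by (auto simp: f_def)
    ultimately show ?thesis by simp
  qed
  finally have eq: "{e \<in> cycle_edges c. v \<in> e} = {{v, c ! s i}, {v, c ! p}}" .
  have "c ! s i \<noteq> c ! p" using p lt i d by (simp add: k_def nth_eq_iff_index_eq)
  moreover have "{v, c ! s i} \<in> edges G" "{v, c ! p} \<in> edges G"
    using is_cycle_edge[OF assms(1), of i] is_cycle_edge[OF assms(1), of p] i p s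
    by (auto simp: k_def insert_commute)
  ultimately show thesis using that eq by blast
qed

text \<open>An edge avoiding \<open>v\<close> would close a triangle in \<open>T\<close>, so the
  negative edges are exactly those at \<open>v\<close>; a cycle uses two of them or none. Hence an
  unbalanced \<open>T\<close> is not a star.\<close>

lemma star_balanced:
  assumes T: "is_spanning_tree T (complete_ugraph n)" and v: "v < n"
    and star: "\<And>w. w < n \<Longrightarrow> w \<noteq> v \<Longrightarrow> {v, w} \<in> edges T"
  shows "balanced (signed_complete n T)"
proof -
  have tree: "\<And>c. \<not> is_cycle T c" and V: "verts T = {0..<n}"
    using T by (auto simp: is_spanning_tree_def is_tree_def complete_ugraph_def)
  have no: "{p, q} \<notin> edges T" if "p < n" "q < n" "p \<noteq> q" "p \<noteq> v" "q \<noteq> v" for p q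
    using tree[of "[v, p, q]"] star[of p] star[of q] that v
    by (auto simp: is_cycle_def is_walk_def V insert_commute)
  show ?thesis unfolding balanced_def positive_cycle_def
  proof (intro allI impI conjI)
    fix c assume c: "is_cycle (signed_complete n T) c"
    then show "is_cycle (signed_complete n T) c" .
    have "cycle_edges c \<subseteq> all_pairs {0..<n}"
      using is_cycle_edge[OF c]
      by (auto simp: cycle_edges_def signed_complete_def complete_ugraph_def)
    moreover have "e \<in> edges T \<longleftrightarrow> v \<in> e" if "e \<in> all_pairs {0..<n}" for e
      using that no star by (auto simp: all_pairs_def card_2_iff insert_commute)
    ultimately have eq: "{e \<in> cycle_edges c. sign (signed_complete n T) e = -1}
        = {e \<in> cycle_edges c. v \<in> e}"
      by (auto simp: signed_complete_def)
    show "even (card {e \<in> cycle_edges c. sign (signed_complete n T) e = -1})"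
    proof (cases "v \<in> set c")
      case True
      then obtain y z where "y \<noteq> z" "{e \<in> cycle_edges c. v \<in> e} = {{v, y}, {v, z}}"
        using cycle_edges_at[OF c] by metis
      then show ?thesis unfolding eq by (simp add: doubleton_eq_iff)
    next
      case False
      then have "{e \<in> cycle_edges c. v \<in> e} = {}"
        by (auto simp: cycle_edges_def)
          (metis mod_less_divisor nth_mem less_nat_zero_code neq0_conv)+
      then show ?thesis unfolding eq by (simp only: card.empty even_zero)
    qed
  qed
qed

section \<open>The competitor double star\<close>

text \<open>The double star \<open>T\<^sub>1\<^sub>,\<^sub>n\<^sub>-\<^sub>3\<close>: the star with centre \<open>a\<close> in which the edge \<open>am\<close> is replaced by \<open>bm\<close>.\<close>

definition ext_star :: "nat \<Rightarrow> nat \<Rightarrow> nat \<Rightarrow> nat \<Rightarrow> nat ugraph" where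
  "ext_star n a b m = \<lparr>verts = {0..<n}, edges = switched n {a} {{m, a}, {m, b}}\<rparr>"

lemma ext_star_edge:
  assumes "a \<noteq> b" "a \<noteq> m" "b \<noteq> m" "b < n" "m < n"
  shows "{i, j} \<in> edges (ext_star n a b m) \<longleftrightarrow> i < n \<and> j < n \<and> i \<noteq> j \<and>
    ((i = a \<and> j \<noteq> m) \<or> (j = a \<and> i \<noteq> m) \<or> (i = b \<and> j = m) \<or> (i = m \<and> j = b))"
  using assms by (auto simp: ext_star_def doubleton_eq_iff)

lemma ext_star_spanning_tree:
  assumes d: "a \<noteq> b" "a \<noteq> m" "b \<noteq> m" and lt: "a < n" "b < n" "m < n"
  shows "is_spanning_tree (ext_star n a b m) (complete_ugraph n)"
proof -
  let ?G = "ext_star n a b m"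
  note E = ext_star_edge[OF d lt(2,3)]
  have V: "verts ?G = {0..<n}" by (simp add: ext_star_def)
  have pairs: "edges ?G \<subseteq> all_pairs {0..<n}" by (simp add: ext_star_def switched_pairs)
  have "\<exists>p. is_walk ?G p \<and> hd p = u \<and> last p = v" if "u < n" "v < n" for u v
  proof -
    \<comment> \<open>The path from \<open>u\<close> to the centre \<open>a\<close>, without
      \<open>a\<close> itself; only \<open>m\<close> has to pass through \<open>b\<close>.\<close>
    define f where "f u = (if u = a then [] else if u = m then [m, b] else [u])" for u
    have "is_walk ?G (f u @ [a] @ rev (f v)) \<and> hd (f u @ [a] @ rev (f v)) = u
        \<and> last (f u @ [a] @ rev (f v)) = v"
      using that d lt by (auto simp: is_walk_def E V f_def)
    then show ?thesis by blast
  qed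
  then have "connected_graph ?G" using lt by (auto simp: connected_graph_def V)
  moreover have "\<not> is_cycle ?G c" for c
  proof
    assume c: "is_cycle ?G c"
    then have "card (set c) \<ge> 3" by (auto simp: is_cycle_def distinct_card)
    then have "\<not> set c \<subseteq> {a, b}"
      using card_mono[of "{a, b}" "set c"] d by auto
    \<comment> \<open>Every vertex other than \<open>a\<close> and \<open>b\<close> has only one
      neighbour, so it cannot lie on a cycle.\<close>
    then obtain w where w: "w \<in> set c" "w \<noteq> a" "w \<noteq> b" by auto
    obtain y z where "y \<noteq> z" "{w, y} \<in> edges ?G" "{w, z} \<in> edges ?G"
      using cycle_edges_at[OF c w(1)] by metis
    then show False using w d by (auto simp: E)
  qed
  ultimately show ?thesis
    using pairs by (auto simp: is_spanning_tree_def is_tree_def simple_graph_def V complete_ugraph_def)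
qed

text \<open>A fourth vertex \<open>w\<close> is joined to neither \<open>b\<close> nor
  \<open>m\<close> by a negative edge, so the triangle on \<open>b\<close>, \<open>m\<close>,
  \<open>w\<close> has \<open>bm\<close> as its only negative edge.\<close>

lemma ext_star_unbalanced:
  assumes d: "a \<noteq> b" "a \<noteq> m" "b \<noteq> m" and lt: "a < n" "b < n" "m < n" and n: "n \<ge> 4"
  shows "\<not> balanced (signed_complete n (ext_star n a b m))"
proof -
  note E = ext_star_edge[OF d lt(2,3)]
  let ?S = "signed_complete n (ext_star n a b m)"
  have "\<not> {0..<n} \<subseteq> {a, b, m}"
  proof
    assume "{0..<n} \<subseteq> {a, b, m}"
    then have "n \<le> card {a, b, m}" using card_mono[of "{a, b, m}" "{0..<n}"] by simp
    then show False using n d by simp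
  qed
  then obtain w where w: "w < n" "w \<noteq> a" "w \<noteq> b" "w \<noteq> m" by fastforce
  have cyc: "is_cycle ?S [b, m, w]"
    using w d lt
    by (auto simp: is_cycle_def is_walk_def signed_complete_def complete_ugraph_def all_pairs_def)
  have "cycle_edges [b, m, w] = {{b, m}, {m, w}, {w, b}}"
    by (simp add: cycle_edges_image lessThan_Suc insert_commute)
  then have "{e \<in> cycle_edges [b, m, w]. sign ?S e = -1} = {{b, m}}"
  proof -
    have "sign ?S {b, m} = -1" "sign ?S {m, w} = 1" "sign ?S {w, b} = 1"
      using w d lt by (simp_all add: signed_complete_def E)
    then show ?thesis unfolding \<open>cycle_edges [b, m, w] = _\<close> by auto
  qed
  then have "odd (card {e \<in> cycle_edges [b, m, w]. sign ?S e = -1})" by simp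
  then show ?thesis using cyc unfolding balanced_def positive_cycle_def by blast
qed

lemma ext_star_isomorphic_double_star:
  assumes d: "a \<noteq> b" "a \<noteq> m" "b \<noteq> m" and lt: "a < n" "b < n" "m < n"
  shows "graph_isomorphic (ext_star n a b m) (double_star 1 (n - 3))"
proof -
  note E = ext_star_edge[OF d lt(2,3)]
  have "{a, b, m} \<subseteq> {0..<n}" using lt by auto
  then have "card ({0..<n} - {a, b, m}) = n - 3" and n: "n \<ge> 3"
    using d card_mono[of "{0..<n}" "{a, b, m}"] by (auto simp: card_Diff_subset)
  then obtain g where g: "bij_betw g ({0..<n} - {a, b, m}) {3..<n}"
    using finite_same_card_bij[of "{0..<n} - {a, b, m}" "{3..<n}"] by auto
  \<comment> \<open>In the double star, 0 is the end with the single pendent vertex 2, and 1 carries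
    the remaining n - 3 pendent vertices.\<close>
  define f where "f = (\<lambda>i. if i = a then 1 else if i = b then 0 else if i = m then 2 else g i)"
  have "bij_betw f (({0..<n} - {a, b, m}) \<union> {a, b, m}) ({3..<n} \<union> {0, 1, 2})"
  proof (rule bij_betw_combine)
    show "bij_betw f ({0..<n} - {a, b, m}) {3..<n}"
      using g by (rule bij_betw_cong[THEN iffD1, rotated]) (auto simp: f_def)
    show "bij_betw f {a, b, m} {0, 1, 2}"
      using d by (auto simp: bij_betw_def f_def inj_on_def)
  qed auto
  moreover have "({0..<n} - {a, b, m}) \<union> {a, b, m} = {0..<n}" using lt by auto
  moreover have "{3..<n} \<union> {0, 1, 2} = {0..<n}" using n by auto
  ultimately have f: "bij_betw f {0..<n} {0..<n}" by simp
  have val: "i = a \<longleftrightarrow> f i = 1" "i = b \<longleftrightarrow> f i = 0" "i = m \<longleftrightarrow> f i = 2" "f i < n" if "i < n" for i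
  proof -
    have "g i \<ge> 3 \<and> g i < n" if "i \<noteq> a" "i \<noteq> b" "i \<noteq> m"
      using bij_betwE[OF g] that \<open>i < n\<close> by auto
    then show "i = a \<longleftrightarrow> f i = 1" "i = b \<longleftrightarrow> f i = 0" "i = m \<longleftrightarrow> f i = 2" "f i < n"
      using d n by (auto simp: f_def)
  qed
  have inj: "f i = f j \<longleftrightarrow> i = j" if "i < n" "j < n" for i j
    using that bij_betw_imp_inj_on[OF f] by (auto simp: inj_on_def)
  have D: "{p, q} \<in> edges (double_star 1 (n - 3)) \<longleftrightarrow> p \<noteq> q \<and>
    ((p = 1 \<and> q \<noteq> 2) \<or> (q = 1 \<and> p \<noteq> 2) \<or> (p = 0 \<and> q = 2) \<or> (p = 2 \<and> q = 0))"
    if "p < n" "q < n" for p q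
    using that n by (auto simp: double_star_def doubleton_eq_iff)
  have "{u, v} \<in> edges (ext_star n a b m) \<longleftrightarrow> {f u, f v} \<in> edges (double_star 1 (n - 3))"
    if "u < n" "v < n" for u v
    unfolding E D[OF val(4)[OF that(1)] val(4)[OF that(2)]] using that val inj by auto
  moreover have "verts (double_star 1 (n - 3)) = {0..<n}" using n by (auto simp: double_star_def)
  ultimately show ?thesis unfolding graph_isomorphic_def
    using f by (intro exI[of _ f]) (auto simp: ext_star_def)
qed

section \<open>Eigenvectors of the complete graph with a negative path on three vertices\<close>

text \<open>The matrix has negative entries, so positivity is computed directly. With
  \<open>s\<close> the sum of all entries, each vertex off the path satisfies (l + 1) y = s. Hence
  these entries share one positive value \<open>t\<close>, and only \<open>a\<close>,
  \<open>b\<close>, \<open>m\<close> need separate treatment.\<close>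

lemma positive_entries_path_eigenvector:
  assumes n: "n \<ge> 6" and d: "a \<noteq> b" "a \<noteq> m" "b \<noteq> m" and lt: "a < n" "b < n" "m < n"
    and nonneg: "\<And>i. y i \<ge> 0" and nz: "\<exists>i<n. y i \<noteq> 0"
    and eig: "\<And>i. i < n \<Longrightarrow> (\<Sum>j<n. sign_entry {{m, a}, {m, b}} i j * y j) = l * y i"
    and i: "i < n"
  shows "y i > 0"
proof -
  define s where "s = (\<Sum>j<n. y j)"
  obtain k where "k < n" "y k > 0" using nz nonneg by (metis less_le)
  then have s: "s > 0" unfolding s_def using nonneg by (intro sum_pos2[of _ k]) auto
  let ?W = "{..<n} - {a, b, m}"
  have sub: "{a, b, m} \<subseteq> {..<n}" using lt by auto
  have cardW: "card ?W = n - 3" using sub d by (simp add: card_Diff_subset)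
  have row: "(\<Sum>j<n. sign_entry {{m, a}, {m, b}} i j * y j)
      = s - y i - 2 * (if i = m then y a + y b else if i = a \<or> i = b then y m else 0)" if "i < n" for i
  proof -
    \<comment> \<open>The matrix is the all-ones matrix minus the identity minus twice the adjacency
      matrix of the path.\<close>
    have "sign_entry {{m, a}, {m, b}} i j * y j = y j - (if j = i then y i else 0)
       - 2 * (if i = m then (if j = a then y a else 0) + (if j = b then y b else 0)
         else if i = a \<or> i = b then (if j = m then y m else 0) else 0)" for j
      using d by (auto simp: sign_entry_def doubleton_eq_iff)
    then show ?thesis using that lt
      by (auto simp: s_def sum_subtractf sum.distrib sum_distrib_left[symmetric])
  qed
  have W: "(l + 1) * y w = s" if "w \<in> ?W" for w
    using eig[of w] row[of w] that by (simp add: algebra_simps)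
  have ea: "(l + 1) * y a = s - 2 * y m" and eb: "(l + 1) * y b = s - 2 * y m"
    and em: "(l + 1) * y m = s - 2 * y a - 2 * y b"
    using eig[of a] row[of a] eig[of b] row[of b] eig[of m] row[of m] lt d
    by (simp_all add: algebra_simps)
  have "?W \<noteq> {}" using cardW n by (intro notI) simp
  then obtain w where w: "w \<in> ?W" by blast
  define t where "t = y w"
  have "(l + 1) * t > 0" using W[OF w] s by (simp add: t_def)
  moreover have "t \<ge> 0" using nonneg by (simp add: t_def)
  ultimately have t: "t > 0" and l: "l + 1 > 0"
    by (auto simp: zero_less_mult_iff)
  have lt_s: "(l + 1) * t = s" using W[OF w] by (simp add: t_def)
  have Wt: "y v = t" if "v \<in> ?W" for v
    using W[OF that] lt_s l by (metis less_irrefl mult_cancel_left)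
  have "s = sum y ?W + sum y {a, b, m}"
    unfolding s_def using sub by (simp add: sum.subset_diff)
  also have "sum y ?W = real (n - 3) * t" using Wt cardW by simp
  finally have total: "s = real (n - 3) * t + (y a + y b + y m)" using d by simp
  \<comment> \<open>Here n >= 6 enters. If \<open>y m = 0\<close>, row \<open>m\<close> gives s = 4t
    while s >= 5t; if \<open>y a = 0\<close>, row \<open>a\<close> gives s = 2t while s >= 4t. With
    only two vertices off the path the first contradiction would disappear.\<close>
  have "real (n - 3) * t \<ge> 3 * t" using n t by (intro mult_right_mono) auto
  then have total3: "s \<ge> 3 * t + (y a + y b + y m)" using total by simp
  have cancel: "u = v" if "(l + 1) * u = (l + 1) * v" for u v
    using that l by simp
  have "y m \<noteq> 0"
  proof
    assume "y m = 0"
    then have "y a = t" using ea lt_s cancel[of "y a" t] by simp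
    moreover have "y b = t" using eb lt_s \<open>y m = 0\<close> cancel[of "y b" t] by simp
    ultimately show False using em total3 t \<open>y m = 0\<close> by simp
  qed
  moreover have ab: "y a = y b" using ea eb cancel[of "y a" "y b"] by simp
  moreover have "y a \<noteq> 0"
  proof
    assume "y a = 0"
    then have "y m = t" using em ab lt_s cancel[of "y m" t] by simp
    then show False using ea total3 t \<open>y a = 0\<close> ab by simp
  qed
  ultimately have "y a > 0" "y b > 0" "y m > 0" using nonneg[of a] nonneg[of b] nonneg[of m] by linarith+
  then show ?thesis using Wt[of i] t i by (cases "i \<in> {a, b, m}") auto
qed

section \<open>Forks and further edges in switched trees\<close>

text \<open>Since \<open>T\<close> has no 4-cycle, two vertices of \<open>S\<close> have at most one common
  neighbour in \<open>T\<close> outside \<open>S\<close>.\<close>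

lemma switched_tree_fork_unbalanced_sides:
  assumes V: "verts T = {0..<n}" and acyc: "\<And>c. \<not> is_cycle T c"
    and S: "S \<subseteq> {0..<n}" "card S \<ge> 2" "card ({0..<n} - S) \<ge> 4"
  defines "B \<equiv> switched n S (edges T)"
  shows "\<exists>a b m p q. a \<noteq> b \<and> {m, a} \<in> B \<and> {m, b} \<in> B \<and> {p, q} \<in> B \<and> {p, q} \<notin> {{m, a}, {m, b}}"
proof -
  obtain s1 s2 where s: "s1 \<in> S" "s2 \<in> S" "s1 \<noteq> s2"
    using S(2) by (metis card_le_Suc0_iff_eq finite_subset finite_atLeastLessThan S(1) not_less_eq_eq numeral_2_eq_2)
  \<comment> \<open>Across the cut, membership in \<open>B\<close> means absence from
    \<open>T\<close>. So a vertex outside both \<open>S\<close> and \<open>W\<close> is a common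
    \<open>T\<close>-neighbour of \<open>s1\<close> and \<open>s2\<close>, and two of those would
    give a 4-cycle.\<close>
  define W where "W = {t \<in> {0..<n} - S. {s1, t} \<in> B \<or> {s2, t} \<in> B}"
  have "card ({0..<n} - S - W) \<le> Suc 0"
  proof (subst card_le_Suc0_iff_eq, simp, intro ballI)
    fix t t' assume t: "t \<in> {0..<n} - S - W" "t' \<in> {0..<n} - S - W"
    then have "{s1, t} \<in> edges T" "{s2, t} \<in> edges T" "{s1, t'} \<in> edges T" "{s2, t'} \<in> edges T"
      using s S(1) by (auto simp: W_def B_def)
    then show "t = t'"
      using acyc[of "[s1, t, s2, t']"] s S(1) t
      by (auto simp: is_cycle_def is_walk_def V insert_commute)
  qed
  moreover have "W \<subseteq> {0..<n} - S" by (auto simp: W_def)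
  then have "card ({0..<n} - S) = card ({0..<n} - S - W) + card W"
    by (metis Diff_partition card_Un_disjoint Diff_disjoint add.commute finite_Diff finite_atLeastLessThan
        finite_subset)
  ultimately have "3 \<le> card W" using S(3) by simp
  then obtain U where U: "U \<subseteq> W" "card U = 3" by (meson obtain_subset_with_card_n)
  then obtain t1 t2 t3 where t: "U = {t1, t2, t3}" "t1 \<noteq> t2" "t1 \<noteq> t3" "t2 \<noteq> t3"
    by (auto simp: card_3_iff)
  have tW: "t1 \<in> W" "t2 \<in> W" "t3 \<in> W" using U t by auto
  then have ne: "t \<noteq> s1" "t \<noteq> s2" if "t \<in> {t1, t2, t3}" for t using that s by (auto simp: W_def)
  have fork: ?thesis
    if "a \<noteq> b" "{m, a} \<in> B" "{m, b} \<in> B" "{p, q} \<in> B" "q \<noteq> a" "q \<noteq> b" "q \<noteq> m" for a b m p q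
    using that by (intro exI[of _ a] exI[of _ b] exI[of _ m] exI[of _ p] exI[of _ q])
      (auto simp: doubleton_eq_iff)
  have hit: "\<exists>w\<in>{s1, s2}. {w, t} \<in> B" if "t \<in> W" for t using that by (auto simp: W_def)
  obtain w1 w2 w3 where w: "w1 \<in> {s1, s2}" "w2 \<in> {s1, s2}" "w3 \<in> {s1, s2}"
    "{w1, t1} \<in> B" "{w2, t2} \<in> B" "{w3, t3} \<in> B"
    using hit[OF tW(1)] hit[OF tW(2)] hit[OF tW(3)] by blast
  \<comment> \<open>Pigeonhole: two of the three vertices of \<open>W\<close> share a
    \<open>B\<close>-neighbour and form the fork; the third supplies the further edge.\<close>
  consider "w1 = w2" | "w1 = w3" | "w2 = w3" using w(1-3) by blast
  then show ?thesis
  proof cases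
    case 1 then show ?thesis using fork[of t1 t2 w1 w3 t3] w t ne[of t3] by auto
  next
    case 2 then show ?thesis using fork[of t1 t3 w1 w2 t2] w t ne[of t2] by auto
  next
    case 3 then show ?thesis using fork[of t2 t3 w2 w1 t1] w t ne[of t1] by auto
  qed
qed

text \<open>Otherwise \<open>T\<close> would contain a \<open>K\<^sub>3\<^sub>,\<^sub>3\<close> minus a matching or two adjacent edges, hence a 4-cycle or
  a 6-cycle.\<close>

lemma switched_tree_fork_three_three:
  assumes V: "verts T = {0..<n}" and acyc: "\<And>c. \<not> is_cycle T c"
    and S: "S \<subseteq> {0..<n}" "card S = 3" "card ({0..<n} - S) = 3"
  defines "B \<equiv> switched n S (edges T)"
  shows "\<exists>a b m p q. a \<noteq> b \<and> {m, a} \<in> B \<and> {m, b} \<in> B \<and> {p, q} \<in> B \<and> {p, q} \<notin> {{m, a}, {m, b}}"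
proof (rule ccontr)
  assume neg: "\<not> ?thesis"
  obtain s1 s2 s3 where s: "S = {s1, s2, s3}" "distinct [s1, s2, s3]"
    using S(2) by (auto simp: card_3_iff)
  obtain t1 t2 t3 where t: "{0..<n} - S = {t1, t2, t3}" "distinct [t1, t2, t3]"
    using S(3) by (auto simp: card_3_iff)
  define M where "M u v \<longleftrightarrow> {u, v} \<in> B" for u v
  have T: "{u, v} \<in> edges T" "{v, u} \<in> edges T"
    if "\<not> M u v" "u \<in> S" "v \<in> {0..<n} - S" for u v
    using that S(1) by (auto simp: M_def B_def insert_commute)
  have square: "M u v \<or> M u v' \<or> M u' v \<or> M u' v'"
    if "u \<in> S" "u' \<in> S" "u \<noteq> u'" "v \<in> {0..<n} - S" "v' \<in> {0..<n} - S" "v \<noteq> v'" for u u' v v'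
  proof (rule ccontr)
    assume "\<not> ?thesis"
    then have "is_cycle T [u, v, u', v']"
      using that T S(1) by (auto simp: is_cycle_def is_walk_def V)
    then show False using acyc by blast
  qed
  have hexagon: "M u v \<or> M u' v \<or> M u' v' \<or> M u'' v' \<or> M u'' v'' \<or> M u v''"
    if "distinct [u, u', u'']" "distinct [v, v', v'']" "{u, u', u''} \<subseteq> S" "{v, v', v''} \<subseteq> {0..<n} - S"
    for u u' u'' v v' v''
  proof (rule ccontr)
    assume "\<not> ?thesis"
    then have "is_cycle T [u, v, u', v', u'', v'']"
      using that T S(1) by (auto simp: is_cycle_def is_walk_def V)
    then show False using acyc by blast
  qed
  \<comment> \<open>By the negated claim, two adjacent edges of \<open>B\<close> exhaust
    \<open>B\<close>. Read as a 3 by 3 table, \<open>M\<close> has no third entry once a row or a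
    column contains two.\<close>
  have row: "\<not> (M u v \<and> M u v' \<and> M u'' v'')"
    if "u \<in> S" "u'' \<in> S" "{v, v', v''} \<subseteq> {0..<n} - S" "v \<noteq> v'" "u \<noteq> u'' \<or> (v \<noteq> v'' \<and> v' \<noteq> v'')"
    for u u'' v v' v''
  proof
    assume "M u v \<and> M u v' \<and> M u'' v''"
    moreover have "{u'', v''} \<notin> {{u, v}, {u, v'}}" using that by (auto simp: doubleton_eq_iff)
    ultimately show False using neg that(4) unfolding M_def by blast
  qed
  have col: "\<not> (M u v \<and> M u' v \<and> M u'' v'')"
    if "{u, u', u''} \<subseteq> S" "{v, v''} \<subseteq> {0..<n} - S" "u \<noteq> u'" "v \<noteq> v'' \<or> (u \<noteq> u'' \<and> u' \<noteq> u'')"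
    for u u' u'' v v''
  proof
    assume "M u v \<and> M u' v \<and> M u'' v''"
    then have "{v, u} \<in> B" "{v, u'} \<in> B" "{u'', v''} \<in> B" by (auto simp: M_def insert_commute)
    moreover have "{u'', v''} \<notin> {{v, u}, {v, u'}}" using that by (auto simp: doubleton_eq_iff)
    ultimately show False using neg that(3) by blast
  qed
  define R where "R = {0..<n} - S"
  note square = square[folded R_def] and hexagon = hexagon[folded R_def]
    and row = row[folded R_def] and col = col[folded R_def]
  have R: "R = {t1, t2, t3}" using t(1) by (simp add: R_def)
  have others: "\<exists>u'\<in>X. \<exists>u''\<in>X. u' \<noteq> u \<and> u'' \<noteq> u \<and> u' \<noteq> u''"
    if "X = {x1, x2, x3}" "distinct [x1, x2, x3]" "u \<in> X" for X u and x1 x2 x3 :: nat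
    using that by auto
  \<comment> \<open>Two entries in row \<open>u\<close> would leave the other two rows empty in
    these columns, contradicting \<open>square\<close>.\<close>
  have row_unique: "v = v'" if h: "M u v" "M u v'" "u \<in> S" "v \<in> R" "v' \<in> R" for u v v'
  proof (rule ccontr)
    assume "v \<noteq> v'"
    obtain u' u'' where u: "u' \<in> S" "u'' \<in> S" "u' \<noteq> u" "u'' \<noteq> u" "u' \<noteq> u''"
      using others[OF s \<open>u \<in> S\<close>] by blast
    obtain x y where "M x y" "x \<in> {u', u''}" "y \<in> {v, v'}"
      using square[OF u(1,2,5) h(4,5) \<open>v \<noteq> v'\<close>] by blast
    then show False using row[of u x v v' y] u h \<open>v \<noteq> v'\<close> by auto
  qed
  have col_unique: "u = u'" if h: "M u v" "M u' v" "u \<in> S" "u' \<in> S" "v \<in> R" for u u' v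
  proof (rule ccontr)
    assume "u \<noteq> u'"
    obtain v' v'' where v: "v' \<in> R" "v'' \<in> R" "v' \<noteq> v" "v'' \<noteq> v" "v' \<noteq> v''"
      using others[OF R t(2) \<open>v \<in> R\<close>] by blast
    obtain x y where "M x y" "x \<in> {u, u'}" "y \<in> {v', v''}"
      using square[OF h(3,4) \<open>u \<noteq> u'\<close> v(1,2,5)] by blast
    then show False using col[of u u' x v y] v h \<open>u \<noteq> u'\<close> by auto
  qed
  \<comment> \<open>If row \<open>u\<close> were empty, \<open>square\<close> would make another row
    meet every pair of columns, hence contain two entries.\<close>
  have ex: "\<exists>v\<in>R. M u v" if u: "u \<in> S" for u
  proof (rule ccontr)
    assume no: "\<not> ?thesis"
    obtain u' where u': "u' \<in> S" "u' \<noteq> u" using others[OF s u] by blast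
    have hit: "M u' v \<or> M u' v'" if "v \<in> R" "v' \<in> R" "v \<noteq> v'" for v v'
      using square[OF u u'(1) u'(2)[symmetric] that] no that by blast
    have "t1 \<in> R" "t2 \<in> R" "t3 \<in> R" "t1 \<noteq> t2" "t1 \<noteq> t3" "t2 \<noteq> t3" using R t(2) by auto
    then show False using hit[of t1 t2] hit[of t1 t3] hit[of t2 t3] row_unique[OF _ _ u'(1)] by metis
  qed
  have sS: "s1 \<in> S" "s2 \<in> S" "s3 \<in> S" "s1 \<noteq> s2" "s1 \<noteq> s3" "s2 \<noteq> s3" using s by auto
  obtain v1 v2 v3 where v: "v1 \<in> R" "v2 \<in> R" "v3 \<in> R" "M s1 v1" "M s2 v2" "M s3 v3"
    using ex[OF sS(1)] ex[OF sS(2)] ex[OF sS(3)] by blast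
  have ne: "v1 \<noteq> v2" "v1 \<noteq> v3" "v2 \<noteq> v3" using v sS col_unique by metis+
  \<comment> \<open>Now \<open>M\<close> is a perfect matching between the sides, and its complement
    in the complete bipartite graph is a 6-cycle in \<open>T\<close>.\<close>
  have "M s1 v3 \<or> M s2 v3 \<or> M s2 v1 \<or> M s3 v1 \<or> M s3 v2 \<or> M s1 v2"
    using hexagon[of s1 s2 s3 v3 v1 v2] v sS ne by simp
  then show False using v sS ne row_unique by metis
qed

text \<open>If no vertex is switched, \<open>B\<close> is the tree itself, and connectedness yields
  a fork and a third edge. If only \<open>v\<close> is switched, a non-neighbour \<open>w\<close> of
  \<open>v\<close> becomes the middle of a fork ending at \<open>v\<close>.\<close>

lemma switched_tree_small_side:
  assumes n: "n \<ge> 4" and V: "verts T = {0..<n}" and E: "edges T \<subseteq> all_pairs {0..<n}"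
    and conn: "connected_graph T"
    and nonstar: "\<And>v. v < n \<Longrightarrow> \<exists>w<n. w \<noteq> v \<and> {v, w} \<notin> edges T"
    and S: "S \<inter> {0..<n} = {} \<or> (\<exists>v<n. S \<inter> {0..<n} = {v})"
  defines "B \<equiv> switched n S (edges T)"
  shows "\<exists>a b m. a \<noteq> b \<and> {m, a} \<in> B \<and> {m, b} \<in> B \<and>
     (edges T = switched n {a} {{m, a}, {m, b}} \<or> (\<exists>p q. {p, q} \<in> B \<and> {p, q} \<notin> {{m, a}, {m, b}}))"
  using S
proof
  assume S: "S \<inter> {0..<n} = {}"
  have B: "{i, j} \<in> B \<longleftrightarrow> {i, j} \<in> edges T" for i j
    using S E by (auto simp: B_def all_pairs_def card_insert_if split: if_splits)
  have outside: "\<exists>x<n. x \<notin> X" if "finite X" "card X < n" for X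
  proof (rule ccontr)
    assume "\<not> ?thesis"
    then have "{0..<n} \<subseteq> X" by auto
    then show False using card_mono[OF that(1), of "{0..<n}"] that(2) by simp
  qed
  \<comment> \<open>Grow a subtree from vertex 0: each of the next three edges reaches a new vertex.
    The second one meets the first in \<open>m\<close>, which gives the fork.\<close>
  obtain u where u: "u \<noteq> 0" "{0, u} \<in> edges T" "u < n"
  proof -
    obtain v where "v < n" "v \<notin> {0}" using outside[of "{0}"] n by auto
    then show ?thesis using connected_crossing_edge[OF conn, of 0 "{0}" v] n that by (auto simp: V)
  qed
  obtain m w where w: "m \<in> {0, u}" "w \<notin> {0, u}" "{m, w} \<in> edges T" "w < n"
  proof -
    obtain v where "v < n" "v \<notin> {0, u}" using outside[of "{0, u}"] n u by auto
    then show ?thesis using connected_crossing_edge[OF conn, of 0 "{0, u}" v] n that by (auto simp: V)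
  qed
  obtain p q where pq: "q \<notin> {0, u, w}" "{p, q} \<in> edges T"
  proof -
    obtain v where "v < n" "v \<notin> {0, u, w}" using outside[of "{0, u, w}"] n u w by auto
    then show ?thesis using connected_crossing_edge[OF conn, of 0 "{0, u, w}" v] n that by (auto simp: V)
  qed
  define a where "a = (if m = 0 then u else 0)"
  have "{m, a} = {0, u}" "a \<in> {0, u}" using w by (auto simp: a_def)
  moreover from this(1) have "{m, a} \<in> edges T" using u by simp
  ultimately have "a \<noteq> w" "{m, a} \<in> B" "{m, w} \<in> B" "{p, q} \<in> B" "{p, q} \<notin> {{m, a}, {m, w}}"
    using w pq by (auto simp: B doubleton_eq_iff)
  then show ?thesis by blast
next
  assume "\<exists>v<n. S \<inter> {0..<n} = {v}"
  then obtain v where v: "v < n" "S \<inter> {0..<n} = {v}" by blast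
  have Sv: "i \<in> S \<longleftrightarrow> i = v" if "i < n" for i
  proof -
    have "i \<in> S \<inter> {0..<n} \<longleftrightarrow> i = v" unfolding v(2) by simp
    then show ?thesis using that by simp
  qed
  obtain w where w: "w < n" "w \<noteq> v" "{v, w} \<notin> edges T" using nonstar v by blast
  obtain u where u: "u \<noteq> w" "{w, u} \<in> edges T" "u < n"
    using connected_crossing_edge[OF conn, of w "{w}" v] v w by (auto simp: V)
  have uv: "u \<noteq> v" using u w by (auto simp: insert_commute)
  have B: "{w, v} \<in> B" "{w, u} \<in> B"
    using u v w uv Sv by (auto simp: B_def insert_commute)
  \<comment> \<open>Switching is an involution: if \<open>B\<close> is just the fork, switching back
    at \<open>v\<close> recovers \<open>T\<close>.\<close>
  have "edges T = switched n {v} {{w, v}, {w, u}}" if "\<And>p q. {p, q} \<in> B \<Longrightarrow> {p, q} \<in> {{w, v}, {w, u}}"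
  proof (rule all_pairs_eqI[OF E switched_pairs])
    fix i j assume ij: "i \<in> {0..<n}" "j \<in> {0..<n}" "i \<noteq> j"
    have "{i, j} \<in> B \<longleftrightarrow> {i, j} \<in> {{w, v}, {w, u}}"
    proof
      assume "{i, j} \<in> {{w, v}, {w, u}}"
      then show "{i, j} \<in> B" by (elim insertE emptyE) (simp_all only: B)
    qed (rule that)
    moreover have "{i, j} \<in> B \<longleftrightarrow> ({i, j} \<in> edges T) \<noteq> ((i = v) \<noteq> (j = v))"
      unfolding B_def switched_iff using ij Sv[of i] Sv[of j] by simp
    moreover have sw: "{i, j} \<in> switched n {v} P \<longleftrightarrow> ({i, j} \<in> P) \<noteq> ((i = v) \<noteq> (j = v))" for P
      unfolding switched_iff using ij by simp
    ultimately show "{i, j} \<in> edges T \<longleftrightarrow> {i, j} \<in> switched n {v} {{w, v}, {w, u}}"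
      using sw[of "{{w, v}, {w, u}}"] by argo
  qed
  then show ?thesis using B uv by (intro exI[of _ v] exI[of _ u] exI[of _ w]) auto
qed

text \<open>Switching at a set and at its complement give the same \<open>B\<close>, so each case on
  the sizes of the two sides may be applied to either side.\<close>

lemma switched_tree_fork:
  fixes S :: "nat set"
  assumes n: "n \<ge> 6" and T: "is_spanning_tree T (complete_ugraph n)"
    and unb: "\<not> balanced (signed_complete n T)"
  defines "B \<equiv> switched n S (edges T)"
  shows "\<exists>a b m. a \<noteq> b \<and> {m, a} \<in> B \<and> {m, b} \<in> B \<and>
     (edges T = switched n {a} {{m, a}, {m, b}} \<or> (\<exists>p q. {p, q} \<in> B \<and> {p, q} \<notin> {{m, a}, {m, b}}))"
proof -
  have V: "verts T = {0..<n}" and E: "edges T \<subseteq> all_pairs {0..<n}"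
    and conn: "connected_graph T" and acyc: "\<And>c. \<not> is_cycle T c"
    using T by (auto simp: is_spanning_tree_def is_tree_def complete_ugraph_def)
  have nonstar: "\<exists>w<n. w \<noteq> v \<and> {v, w} \<notin> edges T" if "v < n" for v
    using star_balanced[OF T that] unb by blast
  define S1 where "S1 = S \<inter> {0..<n}"
  define S2 where "S2 = {0..<n} - S"
  have S12: "S1 \<subseteq> {0..<n}" "S2 \<subseteq> {0..<n}" "{0..<n} - S1 = S2" "{0..<n} - S2 = S1"
    by (auto simp: S1_def S2_def)
  have B1: "switched n S1 (edges T) = B" and B2: "switched n S2 (edges T) = B"
    by (rule all_pairs_eqI[OF switched_pairs];
        auto simp: B_def S1_def S2_def switched_pairs)+
  have "card (S1 \<union> S2) = card S1 + card S2" by (rule card_Un_disjoint) (auto simp: S1_def S2_def)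
  moreover have "S1 \<union> S2 = {0..<n}" by (auto simp: S1_def S2_def)
  ultimately have card: "card S1 + card S2 = n" by simp
  have small: "S' = {} \<or> (\<exists>v<n. S' = {v})" if "card S' \<le> 1" "S' \<subseteq> {0..<n}" for S'
  proof -
    have "finite S'" using that finite_subset by blast
    then show ?thesis using that by (cases "card S' = 0") (auto simp: le_Suc_eq card_1_singleton_iff)
  qed
  have n4: "n \<ge> 4" using n by simp
  note small_case = switched_tree_small_side[OF n4 V E conn nonstar]
  \<comment> \<open>If both sides have at least two of the n >= 6 vertices, then one has at least
    four unless both have exactly three.\<close>
  consider "card S1 \<le> 1" | "card S2 \<le> 1" | "card S1 \<ge> 2" "card S2 \<ge> 4" | "card S2 \<ge> 2" "card S1 \<ge> 4"
    | "card S1 = 3" "card S2 = 3"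
    using card n by linarith
  then show ?thesis
  proof cases
    case 1
    show ?thesis using small_case[of S1] small[OF 1 S12(1)] S12 unfolding B1 by (simp add: Int_absorb2)
  next
    case 2
    show ?thesis using small_case[of S2] small[OF 2 S12(2)] S12 unfolding B2 by (simp add: Int_absorb2)
  next
    case 3
    then show ?thesis
      using switched_tree_fork_unbalanced_sides[OF V acyc S12(1)] unfolding S12 B1 by blast
  next
    case 4
    then show ?thesis
      using switched_tree_fork_unbalanced_sides[OF V acyc S12(2)] unfolding S12 B2 by blast
  next
    case 5
    then show ?thesis
      using switched_tree_fork_three_three[OF V acyc S12(1)] unfolding S12 B1 by blast
  qed
qed

section \<open>Deleting negative edges, and the extremal argument\<close>

lemma quad_sign_entry_antimono:
  assumes nonneg: "\<And>i. y i \<ge> 0" and sub: "F \<subseteq> E"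
  shows "quad n (sign_entry E) y \<le> quad n (sign_entry F) y"
  unfolding quad_def
  by (intro sum_mono mult_right_mono nonneg) (use sub in \<open>auto simp: sign_entry_def\<close>)

lemma quad_sign_entry_strict_antimono:
  assumes pos: "\<And>i. i < n \<Longrightarrow> y i > 0" and sub: "F \<subseteq> E"
    and pq: "p < n" "q < n" "p \<noteq> q" "{p, q} \<in> E" "{p, q} \<notin> F"
  shows "quad n (sign_entry E) y < quad n (sign_entry F) y"
proof -
  have le: "sign_entry E i j * y i * y j \<le> sign_entry F i j * y i * y j" if "i < n" "j < n" for i j
    using pos[of i] pos[of j] that sub
    by (intro mult_right_mono) (auto simp: sign_entry_def)
  have "(\<Sum>j<n. sign_entry E p j * y p * y j) < (\<Sum>j<n. sign_entry F p j * y p * y j)"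
  proof (rule sum_strict_mono_ex1)
    have "sign_entry E p q * y p * y q < sign_entry F p q * y p * y q"
      using pos[of p] pos[of q] pq by (auto simp: sign_entry_def intro: order_less_trans[of _ 0])
    then show "\<exists>j\<in>{..<n}. sign_entry E p j * y p * y j < sign_entry F p j * y p * y j"
      using pq by blast
  qed (use le pq in auto)
  then show ?thesis
    unfolding quad_def by (intro sum_strict_mono_ex1) (use le pq in \<open>auto intro!: sum_mono\<close>)
qed

theorem theorem1:
  fixes n :: nat and T :: "nat ugraph"
  assumes "n \<ge> 6"
    and "is_spanning_tree T (complete_ugraph n)"
    and "\<not> balanced (signed_complete n T)"
    and "\<And>T'. is_spanning_tree T' (complete_ugraph n) \<Longrightarrow> \<not> balanced (signed_complete n T') \<Longrightarrow>
           largest_eigenvalue (adjacency_matrix (signed_complete n T'))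
             \<le> largest_eigenvalue (adjacency_matrix (signed_complete n T))"
  shows "graph_isomorphic T (double_star 1 (n - 3))"
proof -
  have n: "n > 0" "n \<ge> 4" using assms(1) by auto
  define lam where "lam E = largest_eigenvalue (mat n n (\<lambda>(i, j). sign_entry E i j))" for E
  note var = largest_eigenvalue_variational[where a = "sign_entry E" for E, OF sign_entry_sym n(1),
      folded lam_def]
  let ?l = "lam (edges T)"
  obtain x where x: "(\<Sum>i<n. (x i)\<^sup>2) = 1" "quad n (sign_entry (edges T)) x = ?l"
    using var(2) by blast
  define S where "S = {i. x i < 0}"
  define y where "y i = \<bar>x i\<bar>" for i
  define B where "B = switched n S (edges T)"
  have y0: "y i \<ge> 0" for i by (simp add: y_def)
  have y1: "(\<Sum>i<n. (y i)\<^sup>2) = 1" using x by (simp add: y_def)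
  \<comment> \<open>Taking absolute values flips exactly the signs on \<open>S\<close>, so
    \<open>quad_switched\<close> moves the change from the vector to the edge set.\<close>
  have "y = (\<lambda>i. (if i \<in> S then -1 else 1) * x i)" by (auto simp: y_def S_def)
  then have qB: "quad n (sign_entry B) y = ?l"
    using quad_switched x(2) by (simp only: B_def)
  obtain a b m where ab: "a \<noteq> b" and mB: "{m, a} \<in> B" "{m, b} \<in> B"
    and alt: "edges T = switched n {a} {{m, a}, {m, b}} \<or>
      (\<exists>p q. {p, q} \<in> B \<and> {p, q} \<notin> {{m, a}, {m, b}})"
    using switched_tree_fork[OF assms(1-3), of S] unfolding B_def by blast
  have d: "a \<noteq> b" "a \<noteq> m" "b \<noteq> m" and lt: "a < n" "b < n" "m < n"
    using ab mB by (auto simp: B_def)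
  let ?P = "{{m, a}, {m, b}}"
  have "lam (edges (ext_star n a b m)) \<le> ?l"
    using assms(4)[OF ext_star_spanning_tree[OF d lt] ext_star_unbalanced[OF d lt n(2)]]
    by (simp add: adjacency_matrix_signed_complete lam_def)
  \<comment> \<open>The competitor is the path graph switched at \<open>a\<close>; flipping the sign
    of coordinate \<open>a\<close> keeps both the form and the norm.\<close>
  then have bound: "quad n (sign_entry ?P) z \<le> ?l * (\<Sum>i<n. (z i)\<^sup>2)" for z
  proof -
    let ?z = "\<lambda>i. (if i \<in> {a} then -1 else 1) * z i"
    have "quad n (sign_entry ?P) z = quad n (sign_entry (edges (ext_star n a b m))) ?z"
      using quad_switched[of n "{a}" ?P z] by (simp add: ext_star_def)
    also have "\<dots> \<le> lam (edges (ext_star n a b m)) * (\<Sum>i<n. (?z i)\<^sup>2)" by (rule var(1))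
    also have "(\<Sum>i<n. (?z i)\<^sup>2) = (\<Sum>i<n. (z i)\<^sup>2)" by (intro sum.cong) auto
    also have "lam (edges (ext_star n a b m)) * \<dots> \<le> ?l * \<dots>"
      using \<open>lam (edges (ext_star n a b m)) \<le> ?l\<close> by (intro mult_right_mono sum_nonneg) auto
    finally show ?thesis .
  qed
  have sub: "?P \<subseteq> B" using mB by simp
  \<comment> \<open>Sandwich: \<open>?l\<close> is the form of \<open>B\<close> at the unit vector
    \<open>y\<close>, which is at most the form of \<open>?P\<close> there, which is at most
    \<open>?l\<close>.\<close>
  have qP: "quad n (sign_entry ?P) y = ?l * (\<Sum>i<n. (y i)\<^sup>2)"
    using bound[of y] quad_sign_entry_antimono[of y, OF y0 sub, of n] qB y1 by simp
  have "\<exists>i<n. y i \<noteq> 0"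
  proof (rule ccontr)
    assume "\<not> ?thesis"
    then have "(\<Sum>i<n. (y i)\<^sup>2) = 0" by simp
    then show False using y1 by simp
  qed
  then have pos: "y i > 0" if "i < n" for i
    using positive_entries_path_eigenvector[OF assms(1) d lt y0 _
        eigenvector_of_maximiser[OF sign_entry_sym bound qP] that] by blast
  have "\<not> (\<exists>p q. {p, q} \<in> B \<and> {p, q} \<notin> ?P)"
  proof
    assume "\<exists>p q. {p, q} \<in> B \<and> {p, q} \<notin> ?P"
    then obtain p q where pq: "{p, q} \<in> B" "{p, q} \<notin> ?P" by blast
    then have "p < n" "q < n" "p \<noteq> q" by (auto simp: B_def)
    from quad_sign_entry_strict_antimono[of n y, OF pos sub this pq] show False using qB qP y1 by simp
  qed
  then have "T = ext_star n a b m"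
    using alt assms(2) by (intro ugraph.equality) (auto simp: ext_star_def is_spanning_tree_def complete_ugraph_def)
  then show ?thesis using ext_star_isomorphic_double_star[OF d lt] by simp
qed

end
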